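(* Let $K\in L_2(\mathbb R)$ be a kernel (satisfying the standing assumptions below) such that $S_K=T_K$. Then the following are equivalent: (i) $S_K>0$; (ii) there exists a probability density $f\in L_2(\mathbb R)$ such that $\Phi(n,f,K)$ is of exact order $n^{-1}$.
   Context: A kernel is an integrable function $K:\mathbb R\to\mathbb R$ with $\int K=1$; standing assumptions: $K$ is bounded, continuous at $0$, and $\int K^2<2K(0)$. For a sample $X_1,\dots,X_n$ i.i.d. with density $f$ on $\mathbb R$, bandwidth $h>0$, the kernel density estimator is $f_{n,K,h}(x)=\frac1n\sum_{i=1}^n K_h(x-X_i)$ with $K_h(x)=K(x/h)/h$. $\mathrm{MISE}_f(f_{n,K,h})=E_f\int (f_{n,K,h}(x)-f(x))^2dx$, and $\Phi(n,f,K)=\min_{h>0}\mathrm{MISE}_f(f_{n,K,h})$ (the minimum exists under the standing assumptions). $\varphi_K(t)=\int e^{itx}K(x)\,dx$ is the characteristic function (Fourier transform) of $K$. $S_K=\inf\{t\ge0: |\varphi_K(t)-1|\ne0\}$ (the largest $r$ with $\varphi_K\equiv1$ on $[0,r]$), and $T_K=\inf\{r\ge0: |\varphi_K(t)-1|\ne0 \text{ for a.e. } t\ge r\}$. "$\Phi(n,f,K)$ is of exact order $n^{-1}$" means there exist constants $0<c\le C<\infty$ and $n_0$ such that $c/n\le\Phi(n,f,K)\le C/n$ for all $n\ge n_0$. *)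

theory Defs
  imports "HOL-Probability.Probability"
begin

definition std_kernel :: "(real \<Rightarrow> real) \<Rightarrow> bool" where
  "std_kernel K \<longleftrightarrow> integrable lborel K \<and> (\<integral>x. K x \<partial>lborel) = 1
     \<and> bounded (range K) \<and> isCont K 0
     \<and> integrable lborel (\<lambda>x. (K x)\<^sup>2)
     \<and> (\<integral>x. (K x)\<^sup>2 \<partial>lborel) < 2 * K 0"

definition L2 :: "(real \<Rightarrow> real) \<Rightarrow> bool" where
  "L2 g \<longleftrightarrow> g \<in> borel_measurable lborel \<and> integrable lborel (\<lambda>x. (g x)\<^sup>2)"

definition prob_density :: "(real \<Rightarrow> real) \<Rightarrow> bool" where
  "prob_density f \<longleftrightarrow> f \<in> borel_measurable lborel \<and> (\<forall>x. 0 \<le> f x)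
     \<and> (\<integral>\<^sup>+ x. ennreal (f x) \<partial>lborel) = 1"

definition charfun_K :: "(real \<Rightarrow> real) \<Rightarrow> real \<Rightarrow> complex" where
  "charfun_K K t = (\<integral>x. cis (t * x) * complex_of_real (K x) \<partial>lborel)"

definition S_K :: "(real \<Rightarrow> real) \<Rightarrow> real" where
  "S_K K = Inf {t. 0 \<le> t \<and> cmod (charfun_K K t - 1) \<noteq> 0}"

definition T_K :: "(real \<Rightarrow> real) \<Rightarrow> real" where
  "T_K K = Inf {r. 0 \<le> r \<and> (AE t in lborel. r \<le> t \<longrightarrow> cmod (charfun_K K t - 1) \<noteq> 0)}"

text \<open>The sample \<open>X\<^sub>1,\<dots>,X\<^sub>n\<close> is represented as \<open>X 0, \<dots>, X (n-1)\<close>.\<close>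
definition kde :: "nat \<Rightarrow> (real \<Rightarrow> real) \<Rightarrow> real \<Rightarrow> (nat \<Rightarrow> real) \<Rightarrow> real \<Rightarrow> real" where
  "kde n K h X x = (1 / real n) * (\<Sum>i<n. K ((x - X i) / h) / h)"

definition sample_law :: "nat \<Rightarrow> (real \<Rightarrow> real) \<Rightarrow> (nat \<Rightarrow> real) measure" where
  "sample_law n f = PiM {..<n} (\<lambda>_. density lborel f)"

definition MISE :: "nat \<Rightarrow> (real \<Rightarrow> real) \<Rightarrow> (real \<Rightarrow> real) \<Rightarrow> real \<Rightarrow> ennreal" where
  "MISE n f K h = (\<integral>\<^sup>+ X. (\<integral>\<^sup>+ x. ennreal ((kde n K h X x - f x)\<^sup>2) \<partial>lborel) \<partial>sample_law n f)"

definition Phi :: "nat \<Rightarrow> (real \<Rightarrow> real) \<Rightarrow> (real \<Rightarrow> real) \<Rightarrow> ennreal" where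
  "Phi n f K = (INF h\<in>{0<..}. MISE n f K h)"

definition exact_order_inv_n :: "(nat \<Rightarrow> ennreal) \<Rightarrow> bool" where
  "exact_order_inv_n \<Phi> \<longleftrightarrow> (\<exists>c C n0. 0 < c \<and> c \<le> C \<and>
     (\<forall>n\<ge>n0. ennreal (c / real n) \<le> \<Phi> n \<and> \<Phi> n \<le> ennreal (C / real n)))"

end

theory Submission
  imports Defs
begin

text \<open>
  Write \<open>m\<^sub>h = K\<^sub>h * f\<close>. The risk splits as \<open>V\<^sub>h / n + B\<^sub>h\<close>, where \<open>V\<^sub>h\<close> is the integral over \<open>x\<close> of the
  variance of \<open>K\<^sub>h (x - X)\<close> and \<open>B\<^sub>h\<close> is the squared \<open>L\<^sub>2\<close> norm of \<open>m\<^sub>h - f\<close>; moreover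
  \<open>V\<^sub>h + \<integral> m\<^sub>h\<^sup>2 = \<integral> K\<^sup>2 / h\<close>.

  If \<open>S\<^sub>K > 0\<close>, take for \<open>f\<close> the band-limited Fejer density and \<open>h\<close> small: then \<open>m\<^sub>h = f\<close>, so the risk is
  at most \<open>\<integral> K\<^sup>2 / (n h)\<close>. Conversely the risk is at least \<open>(V\<^sub>h + B\<^sub>h) / n\<close>, which is
  \<open>1 / n\<close> times the mean of \<open>\<integral> (K\<^sub>h (u) - f (u + X))\<^sup>2 du\<close>, and this is bounded below by the integral
  over \<open>u\<close> of the variance of \<open>f (u + X)\<close>, a positive number that depends neither on \<open>h\<close> nor on \<open>K\<close>.

  If \<open>\<Phi> (n) \<le> C / n\<close>, choose \<open>h\<^sub>n\<close> with risk at most \<open>2 C / n\<close>. Then \<open>V\<close> stays bounded and \<open>B\<close> tends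
  to \<open>0\<close>, and the identity for \<open>V\<^sub>h\<close> confines \<open>h\<^sub>n\<close> to a compact subset of \<open>(0, \<infinity>)\<close>. Along a
  subsequence \<open>h\<^sub>n\<close> tends to some \<open>l > 0\<close>, and in the limit
  \<open>(\<phi>\<^sub>K (l t) - 1) \<phi>\<^sub>f (t) = 0\<close> for all \<open>t \<ge> 0\<close>. As \<open>\<phi>\<^sub>f (0) = 1\<close>, \<open>\<phi>\<^sub>K = 1\<close> near \<open>0\<close>.
  Finally \<open>\<phi>\<^sub>K\<close> is not identically \<open>1\<close>, since otherwise \<open>m\<^sub>h = f\<close> for the Fejer density and every \<open>h\<close>,
  so that \<open>\<integral> f\<^sup>2 \<le> \<integral> K\<^sup>2 / h\<close> for every \<open>h\<close>; hence \<open>S\<^sub>K\<close> is not the infimum of the empty set.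
\<close>

subsection \<open>Bias and variance of kernel means\<close>

definition conv_mean :: "real measure \<Rightarrow> (real \<Rightarrow> real) \<Rightarrow> real \<Rightarrow> real" where
  "conv_mean M k x = (\<integral>y. k (x - y) \<partial>M)"

text \<open>The outer integral is extended nonnegative, so Tonelli applies with no integrability
  condition. For bounded measurable \<open>k\<close> and a probability law \<open>M\<close> the
  inner Bochner integral is a true variance, not a default value.\<close>

definition int_var :: "real measure \<Rightarrow> (real \<Rightarrow> real) \<Rightarrow> ennreal" where
  "int_var M k = (\<integral>\<^sup>+x. ennreal (\<integral>y. (k (x - y) - conv_mean M k x)\<^sup>2 \<partial>M) \<partial>lborel)"

definition int_sq_bias :: "real measure \<Rightarrow> (real \<Rightarrow> real) \<Rightarrow> (real \<Rightarrow> real) \<Rightarrow> ennreal" where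
  "int_sq_bias M k f = (\<integral>\<^sup>+x. ennreal ((conv_mean M k x - f x)\<^sup>2) \<partial>lborel)"

context real_distribution
begin

lemma integrable_bounded_borel:
  fixes u :: "real \<Rightarrow> real"
  assumes "u \<in> borel_measurable borel" "\<And>x. \<bar>u x\<bar> \<le> b"
  shows "integrable M u"
  using assms by (intro integrable_const_bound[where B=b]) auto

text \<open>Bias-variance decomposition: the cross term vanishes because
  \<open>u - expectation u\<close> has mean zero. Boundedness supplies the moments.\<close>

lemma nn_integral_sq_shift:
  fixes u :: "real \<Rightarrow> real"
  assumes [measurable]: "u \<in> borel_measurable borel" and b: "\<And>x. \<bar>u x\<bar> \<le> b"
  shows "(\<integral>\<^sup>+y. ennreal ((u y - a)\<^sup>2) \<partial>M)
    = ennreal ((\<integral>y. (u y - expectation u)\<^sup>2 \<partial>M) + (expectation u - a)\<^sup>2)"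
proof -
  have iu[simp]: "integrable M u" using assms by (rule integrable_bounded_borel)
  have "(u x)\<^sup>2 \<le> b\<^sup>2" for x using b[of x] by (simp add: abs_le_square_iff[symmetric])
  then have iu2[simp]: "integrable M (\<lambda>y. (u y)\<^sup>2)" by (intro integrable_bounded_borel[where b="b\<^sup>2"]) auto
  have i: "integrable M (\<lambda>y. (u y - a)\<^sup>2)" for a
    unfolding power2_diff by auto
  have e: "(\<integral>y. (u y - a)\<^sup>2 \<partial>M) = (\<integral>y. (u y)\<^sup>2 \<partial>M) - 2 * a * expectation u + a\<^sup>2" for a
    unfolding power2_diff by (simp add: prob_space[unfolded space_eq_univ])
  have "(\<integral>\<^sup>+y. ennreal ((u y - a)\<^sup>2) \<partial>M) = ennreal (\<integral>y. (u y - a)\<^sup>2 \<partial>M)"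
    by (intro nn_integral_eq_integral i) auto
  also have "(\<integral>y. (u y - a)\<^sup>2 \<partial>M) = (\<integral>y. (u y - expectation u)\<^sup>2 \<partial>M) + (expectation u - a)\<^sup>2"
    unfolding e by (simp add: power2_eq_square algebra_simps)
  finally show ?thesis .
qed

text \<open>The offset \<open>c\<close> stays arbitrary in the induction: once the last coordinate
  \<open>y\<close> is fixed, \<open>v y\<close> joins the offset, and what remains to be integrated
  over \<open>y\<close> is a second moment of a centred variable about \<open>- c\<close>.\<close>

lemma nn_integral_iid_sum_sq:
  fixes v :: "real \<Rightarrow> real"
  assumes [measurable]: "v \<in> borel_measurable borel" and b: "\<And>x. \<bar>v x\<bar> \<le> b"
    and mean: "expectation v = 0"
  shows "(\<integral>\<^sup>+X. ennreal (((\<Sum>i<n. v (X i)) + c)\<^sup>2) \<partial>PiM {..<n::nat} (\<lambda>_. M))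
    = ennreal (real n * (\<integral>y. (v y)\<^sup>2 \<partial>M) + c\<^sup>2)"
proof (induction n arbitrary: c)
  case 0
  interpret P: product_prob_space "\<lambda>_::nat. M" "{..<0}" by standard
  show ?case using P.emeasure_space_1 by (simp del: space_PiM)
next
  case (Suc n)
  interpret P: product_prob_space "\<lambda>_::nat. M" UNIV by standard
  have "(v x)\<^sup>2 \<le> b\<^sup>2" for x using b[of x] by (simp add: abs_le_square_iff[symmetric])
  then have nn: "0 \<le> (\<integral>y. (v y)\<^sup>2 \<partial>M)" by auto
  have "(\<integral>\<^sup>+X. ennreal (((\<Sum>i<Suc n. v (X i)) + c)\<^sup>2) \<partial>PiM {..<Suc n} (\<lambda>_. M))
    = (\<integral>\<^sup>+ y. (\<integral>\<^sup>+ X. ennreal (((\<Sum>i<Suc n. v ((X(n := y)) i)) + c)\<^sup>2) \<partial>PiM {..<n} (\<lambda>_. M)) \<partial>M)"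
    unfolding lessThan_Suc by (subst P.product_nn_integral_insert_rev) auto
  also have "\<dots> = (\<integral>\<^sup>+ y. (\<integral>\<^sup>+ X. ennreal (((\<Sum>i<n. v (X i)) + (v y + c))\<^sup>2) \<partial>PiM {..<n} (\<lambda>_. M)) \<partial>M)"
    by (intro nn_integral_cong arg_cong[where f=ennreal] arg_cong[where f="\<lambda>x. x\<^sup>2"])
       (auto simp: lessThan_Suc algebra_simps intro!: sum.cong)
  also have "\<dots> = (\<integral>\<^sup>+ y. ennreal (real n * (\<integral>y. (v y)\<^sup>2 \<partial>M)) + ennreal ((v y - (- c))\<^sup>2) \<partial>M)"
    unfolding Suc.IH using nn by (intro nn_integral_cong) (simp add: ennreal_plus[symmetric] del: ennreal_plus)
  also have "\<dots> = ennreal (real n * (\<integral>y. (v y)\<^sup>2 \<partial>M)) + (\<integral>\<^sup>+ y. ennreal ((v y - (- c))\<^sup>2) \<partial>M)"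
    by (subst nn_integral_add) (auto simp: emeasure_space_1[unfolded space_eq_univ])
  also have "(\<integral>\<^sup>+ y. ennreal ((v y - (- c))\<^sup>2) \<partial>M) = ennreal ((\<integral>y. (v y)\<^sup>2 \<partial>M) + c\<^sup>2)"
    by (subst nn_integral_sq_shift[OF assms(1) b]) (auto simp: mean)
  also have "ennreal (real n * (\<integral>y. (v y)\<^sup>2 \<partial>M)) + ennreal ((\<integral>y. (v y)\<^sup>2 \<partial>M) + c\<^sup>2)
     = ennreal (real (Suc n) * (\<integral>y. (v y)\<^sup>2 \<partial>M) + c\<^sup>2)"
    using nn by (subst ennreal_plus[symmetric]) (auto simp: algebra_simps)
  finally show ?case .
qed

lemma nn_integral_iid_mean_sq:
  fixes u :: "real \<Rightarrow> real"
  assumes [measurable]: "u \<in> borel_measurable borel" and b: "\<And>x. \<bar>u x\<bar> \<le> b" and n: "n > 0"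
  shows "(\<integral>\<^sup>+X. ennreal ((1 / real n * (\<Sum>i<n. u (X i)) - a)\<^sup>2) \<partial>PiM {..<n::nat} (\<lambda>_. M))
    = ennreal ((\<integral>y. (u y - expectation u)\<^sup>2 \<partial>M) / real n + (expectation u - a)\<^sup>2)"
proof -
  \<comment> \<open>Centring moves the bias \<open>expectation u - a\<close> into the offset;
    dividing by \<open>n\<close> turns the factor \<open>n\<close> of the sum into
    \<open>1 / n\<close>.\<close>
  let ?v = "\<lambda>y. (u y - expectation u) / real n"
  have iu[simp]: "integrable M u" using assms(1,2) by (rule integrable_bounded_borel)
  have *: "1 / real n * (\<Sum>i<n. u (X i)) - a = (\<Sum>i<n. ?v (X i)) + (expectation u - a)" for X
    using n by (simp add: sum_subtractf sum_divide_distrib[symmetric] field_simps)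
  have "(\<integral>\<^sup>+X. ennreal ((1 / real n * (\<Sum>i<n. u (X i)) - a)\<^sup>2) \<partial>PiM {..<n::nat} (\<lambda>_. M))
    = ennreal (real n * (\<integral>y. (?v y)\<^sup>2 \<partial>M) + (expectation u - a)\<^sup>2)"
    unfolding *
  proof (rule nn_integral_iid_sum_sq)
    show "\<bar>(u x - expectation u) / real n\<bar> \<le> (b + \<bar>expectation u\<bar>) / real n" for x
      using b[of x] by (auto simp: abs_divide intro!: divide_right_mono)
    show "(\<integral>x. (u x - expectation u) / real n \<partial>M) = 0"
      by (simp add: prob_space[unfolded space_eq_univ])
  qed simp
  also have "real n * (\<integral>y. (?v y)\<^sup>2 \<partial>M) = (\<integral>y. (u y - expectation u)\<^sup>2 \<partial>M) / real n"
    using n by (simp add: power_divide power2_eq_square)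
  finally show ?thesis .
qed

end

locale bounded_kernel_mean = real_distribution +
  fixes k :: "real \<Rightarrow> real" and b :: real
  assumes k_meas[measurable]: "k \<in> borel_measurable borel"
    and k_bound: "\<And>x. \<bar>k x\<bar> \<le> b"
begin

abbreviation "m \<equiv> conv_mean M k"

sublocale LM: pair_sigma_finite lborel M by standard

lemma m_meas[measurable]: "m \<in> borel_measurable borel"
  unfolding conv_mean_def by measurable

lemma kernel_second_moment:
  "(\<integral>\<^sup>+y. ennreal ((k (x - y) - a)\<^sup>2) \<partial>M)
    = ennreal (\<integral>y. (k (x - y) - m x)\<^sup>2 \<partial>M) + ennreal ((m x - a)\<^sup>2)"
proof -
  have "(\<integral>\<^sup>+y. ennreal ((k (x - y) - a)\<^sup>2) \<partial>M)
    = ennreal ((\<integral>y. (k (x - y) - m x)\<^sup>2 \<partial>M) + (m x - a)\<^sup>2)"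
    unfolding conv_mean_def using k_bound by (intro nn_integral_sq_shift) auto
  then show ?thesis by (simp add: ennreal_plus)
qed

lemma mean_integrated_sq_error:
  assumes [measurable]: "f \<in> borel_measurable borel" and n: "n > 0"
  shows "(\<integral>\<^sup>+X. (\<integral>\<^sup>+x. ennreal ((1 / real n * (\<Sum>i<n. k (x - X i)) - f x)\<^sup>2) \<partial>lborel) \<partial>PiM {..<n::nat} (\<lambda>_. M))
    = int_var M k / ennreal (real n) + int_sq_bias M k f"
proof -
  interpret P: product_prob_space "\<lambda>_::nat. M" "{..<n}" by standard
  interpret PL: pair_sigma_finite "PiM {..<n} (\<lambda>_. M)" lborel by standard
  have "(\<integral>\<^sup>+X. (\<integral>\<^sup>+x. ennreal ((1 / real n * (\<Sum>i<n. k (x - X i)) - f x)\<^sup>2) \<partial>lborel) \<partial>PiM {..<n::nat} (\<lambda>_. M))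
   = (\<integral>\<^sup>+x. (\<integral>\<^sup>+X. ennreal ((1 / real n * (\<Sum>i<n. k (x - X i)) - f x)\<^sup>2) \<partial>PiM {..<n::nat} (\<lambda>_. M)) \<partial>lborel)"
    by (subst PL.Fubini') auto
  also have "\<dots> = (\<integral>\<^sup>+x. ennreal ((\<integral>y. (k (x - y) - m x)\<^sup>2 \<partial>M) / real n + (m x - f x)\<^sup>2) \<partial>lborel)"
    unfolding conv_mean_def using n k_bound by (intro nn_integral_cong nn_integral_iid_mean_sq) auto
  also have "\<dots> = (\<integral>\<^sup>+x. ennreal (\<integral>y. (k (x - y) - m x)\<^sup>2 \<partial>M) / ennreal (real n) + ennreal ((m x - f x)\<^sup>2) \<partial>lborel)"
    using n by (intro nn_integral_cong) (simp add: ennreal_plus divide_ennreal)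
  also have "\<dots> = int_var M k / ennreal (real n) + int_sq_bias M k f"
    unfolding int_var_def int_sq_bias_def by (subst nn_integral_add) (auto simp: nn_integral_divide)
  finally show ?thesis .
qed

text \<open>Take second moments about \<open>0\<close> and integrate over \<open>x\<close> first: by
  translation invariance the inner integral does not depend on \<open>y\<close>, and
  \<open>M\<close> has mass one.\<close>

lemma int_var_add_sq_mean:
  "int_var M k + (\<integral>\<^sup>+x. ennreal ((m x)\<^sup>2) \<partial>lborel) = (\<integral>\<^sup>+x. ennreal ((k x)\<^sup>2) \<partial>lborel)"
proof -
  have "int_var M k + (\<integral>\<^sup>+x. ennreal ((m x)\<^sup>2) \<partial>lborel) = (\<integral>\<^sup>+x. (\<integral>\<^sup>+y. ennreal ((k (x - y))\<^sup>2) \<partial>M) \<partial>lborel)"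
    using kernel_second_moment[where a=0] unfolding int_var_def
    by (subst nn_integral_add[symmetric]) auto
  also have "\<dots> = (\<integral>\<^sup>+y. (\<integral>\<^sup>+x. ennreal ((k (x - y))\<^sup>2) \<partial>lborel) \<partial>M)"
    by (subst LM.Fubini'[symmetric]) auto
  also have "\<dots> = (\<integral>\<^sup>+y. (\<integral>\<^sup>+x. ennreal ((k x)\<^sup>2) \<partial>lborel) \<partial>M)"
  proof (rule nn_integral_cong)
    fix y
    show "(\<integral>\<^sup>+x. ennreal ((k (x - y))\<^sup>2) \<partial>lborel) = (\<integral>\<^sup>+x. ennreal ((k x)\<^sup>2) \<partial>lborel)"
      using nn_integral_real_affine[of "\<lambda>x. ennreal ((k x)\<^sup>2)" 1 "-y"] by simp
  qed
  finally show ?thesis by (simp add: emeasure_space_1[unfolded space_eq_univ])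
qed

text \<open>After the shift \<open>x = u + y\<close> the kernel value no longer depends on \<open>y\<close>, and a variance is the
  smallest second moment about a constant: this removes the kernel from the lower bound.\<close>

lemma int_var_add_bias_ge:
  assumes [measurable]: "f \<in> borel_measurable borel" and f: "\<And>x. \<bar>f x\<bar> \<le> c"
  shows "(\<integral>\<^sup>+u. ennreal (\<integral>y. (f (u + y) - (\<integral>y. f (u + y) \<partial>M))\<^sup>2 \<partial>M) \<partial>lborel)
    \<le> int_var M k + int_sq_bias M k f"
proof -
  have "int_var M k + int_sq_bias M k f = (\<integral>\<^sup>+x. (\<integral>\<^sup>+y. ennreal ((k (x - y) - f x)\<^sup>2) \<partial>M) \<partial>lborel)"
    using kernel_second_moment unfolding int_var_def int_sq_bias_def
    by (subst nn_integral_add[symmetric]) auto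
  also have "\<dots> = (\<integral>\<^sup>+y. (\<integral>\<^sup>+x. ennreal ((k (x - y) - f x)\<^sup>2) \<partial>lborel) \<partial>M)"
    by (subst LM.Fubini'[symmetric]) auto
  also have "\<dots> = (\<integral>\<^sup>+y. (\<integral>\<^sup>+u. ennreal ((f (u + y) - k u)\<^sup>2) \<partial>lborel) \<partial>M)"
  proof (rule nn_integral_cong)
    fix y
    show "(\<integral>\<^sup>+x. ennreal ((k (x - y) - f x)\<^sup>2) \<partial>lborel) = (\<integral>\<^sup>+u. ennreal ((f (u + y) - k u)\<^sup>2) \<partial>lborel)"
      using nn_integral_real_affine[of "\<lambda>x. ennreal ((k (x - y) - f x)\<^sup>2)" 1 y]
      by (simp add: ac_simps power2_commute)
  qed
  also have "\<dots> = (\<integral>\<^sup>+u. (\<integral>\<^sup>+y. ennreal ((f (u + y) - k u)\<^sup>2) \<partial>M) \<partial>lborel)"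
    by (subst LM.Fubini'[symmetric]) auto
  also have "\<dots> = (\<integral>\<^sup>+u. ennreal ((\<integral>y. (f (u + y) - (\<integral>y. f (u + y) \<partial>M))\<^sup>2 \<partial>M)
      + ((\<integral>y. f (u + y) \<partial>M) - k u)\<^sup>2) \<partial>lborel)"
    using f by (intro nn_integral_cong nn_integral_sq_shift) auto
  also have "\<dots> \<ge> (\<integral>\<^sup>+u. ennreal (\<integral>y. (f (u + y) - (\<integral>y. f (u + y) \<partial>M))\<^sup>2 \<partial>M) \<partial>lborel)"
    by (intro nn_integral_mono ennreal_leI) auto
  finally show ?thesis .
qed

end

subsection \<open>Fourier transforms\<close>

lemma norm_charfun_K_le: "cmod (charfun_K K t) \<le> (\<integral>x. \<bar>K x\<bar> \<partial>lborel)"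
proof -
  have "cmod (charfun_K K t) \<le> (\<integral>x. cmod (cis (t * x) * complex_of_real (K x)) \<partial>lborel)"
    unfolding charfun_K_def by (rule integral_norm_bound)
  then show ?thesis by (simp add: norm_mult)
qed

lemma integrable_charfun_K:
  fixes K :: "real \<Rightarrow> real"
  assumes "integrable lborel K"
  shows "integrable lborel (\<lambda>x. cis (t * x) * complex_of_real (K x))"
  by (rule Bochner_Integration.integrable_bound[OF assms]) (use assms in \<open>auto simp: norm_mult cis_conv_exp\<close>)

lemma isCont_charfun_K:
  assumes "integrable lborel K"
  shows "isCont (charfun_K K) t"
  unfolding continuous_at_sequentially
proof safe
  fix X assume X: "X \<longlonglongrightarrow> t"
  show "(charfun_K K \<circ> X) \<longlonglongrightarrow> charfun_K K t"
    unfolding comp_def charfun_K_def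
    by (rule integral_dominated_convergence[where w="\<lambda>x. \<bar>K x\<bar>"])
       (use assms in \<open>auto intro!: tendsto_intros X simp: norm_mult cis_conv_exp\<close>)
qed

lemma charfun_K_measurable [measurable]:
  "integrable lborel K \<Longrightarrow> charfun_K K \<in> borel_measurable borel"
  by (auto intro!: borel_measurable_continuous_onI continuous_at_imp_continuous_on isCont_charfun_K)

lemma charfun_K_uminus: "charfun_K K (- t) = cnj (charfun_K K t)"
  unfolding charfun_K_def by (simp add: cis_cnj flip: Bochner_Integration.integral_cnj)

lemma charfun_K_reflect:
  assumes "integrable lborel K"
  shows "charfun_K (\<lambda>y. K (x - y)) t = cis (t * x) * charfun_K K (- t)"
proof -
  have "charfun_K (\<lambda>y. K (x - y)) t
     = (\<integral>y. cis (t * (x - y)) * complex_of_real (K y) \<partial>lborel)"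
    unfolding charfun_K_def
    by (subst lborel_integral_real_affine[where c="-1" and t=x]) auto
  also have "\<dots> = (\<integral>y. cis (t * x) * (cis (- t * y) * complex_of_real (K y)) \<partial>lborel)"
    by (intro Bochner_Integration.integral_cong refl) (simp add: cis_mult algebra_simps)
  also have "\<dots> = cis (t * x) * charfun_K K (- t)"
    unfolding charfun_K_def by simp
  finally show ?thesis .
qed

lemma charfun_K_diff:
  assumes "integrable lborel f" "integrable lborel g"
  shows "charfun_K (\<lambda>x. f x - g x) t = charfun_K f t - charfun_K g t"
  unfolding charfun_K_def
  using integrable_charfun_K[OF assms(1)] integrable_charfun_K[OF assms(2)]
  by (simp add: right_diff_distrib)

lemma charfun_K_density:
  assumes [measurable]: "f \<in> borel_measurable borel" and "\<And>x. 0 \<le> f x"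
  shows "charfun_K f t = char (density lborel f) t"
  unfolding charfun_K_def char_def using assms(2)
  by (subst integral_density) (auto simp: cis_conv_exp scaleR_conv_of_real mult.commute)

text \<open>Both sides are iterated integrals of \<open>cis (t * x) * D x\<close> over
  \<open>lborel\<close> and \<open>M\<close>; the modulus is \<open>\<bar>D x\<bar>\<close>,
  integrable because \<open>M\<close> has mass one. This duality takes the place of Fourier
  inversion below.\<close>

lemma (in real_distribution) multiplication_formula:
  assumes D: "integrable lborel D"
  shows "(\<integral>x. D x * char M x \<partial>lborel) = (\<integral>t. charfun_K D t \<partial>M)"
proof -
  interpret LM: pair_sigma_finite lborel M by standard
  have [measurable]: "D \<in> borel_measurable borel" using D by auto
  have int: "integrable (lborel \<Otimes>\<^sub>M M) (\<lambda>(x,t). cis (t * x) * complex_of_real (D x))"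
  proof (rule LM.Fubini_integrable)
    show "integrable lborel (\<lambda>x. \<integral>y. norm (case (x, y) of (x, t) \<Rightarrow> cis (t * x) * complex_of_real (D x)) \<partial>M)"
      using D by (simp add: norm_mult prob_space[unfolded space_eq_univ])
    show "AE x in lborel. integrable M (\<lambda>y. case (x, y) of (x, t) \<Rightarrow> cis (t * x) * complex_of_real (D x))"
      by (auto intro!: integrable_const_bound[where B="\<bar>D _\<bar>"] simp: cis_conv_exp norm_mult)
  qed (auto simp: cis_conv_exp)
  have "(\<integral>x. D x * char M x \<partial>lborel) = (\<integral>x. (\<integral>t. cis (t * x) * complex_of_real (D x) \<partial>M) \<partial>lborel)"
    unfolding char_def by (simp add: cis_conv_exp mult.commute)
  also have "\<dots> = (\<integral>t. (\<integral>x. cis (t * x) * complex_of_real (D x) \<partial>lborel) \<partial>M)"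
    using LM.Fubini_integral[OF int] by simp
  finally show ?thesis unfolding charfun_K_def .
qed

text \<open>By the multiplication formula, convolving \<open>char M\<close> with \<open>k\<close>
  weights \<open>M\<close> by the transform of \<open>k\<close> at \<open>- t\<close>, the conjugate
  of its value at \<open>t\<close>. Where this weight is one, convolution changes nothing.\<close>

lemma (in real_distribution) integral_mult_char_reflect:
  assumes k: "integrable lborel k" and one: "AE t in M. charfun_K k t = 1"
  shows "(\<integral>y. k (x - y) * char M y \<partial>lborel) = char M x"
proof -
  have i: "integrable lborel (\<lambda>y. k (x - y))"
    using lborel_integrable_real_affine[OF k, of "-1" x] by simp
  have "(\<integral>y. k (x - y) * char M y \<partial>lborel) = (\<integral>t. cis (t * x) * charfun_K k (- t) \<partial>M)"
    unfolding charfun_K_reflect[OF k, symmetric] by (rule multiplication_formula[OF i])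
  also have "\<dots> = (\<integral>t. iexp (x * t) \<partial>M)"
  proof (rule integral_cong_AE)
    show "AE t in M. cis (t * x) * charfun_K k (- t) = iexp (x * t)"
      using one by eventually_elim (simp add: charfun_K_uminus cis_conv_exp mult.commute)
  qed (use k in \<open>auto simp: cis_conv_exp\<close>)
  finally show ?thesis by (simp add: char_def)
qed

locale integrable_kernel_mean = bounded_kernel_mean +
  assumes k_int: "integrable lborel k"
begin

lemma integrable_pair: "integrable (lborel \<Otimes>\<^sub>M M) (\<lambda>(x,y). k (x - y))"
proof -
  \<comment> \<open>With \<open>M\<close> outermost the inner norm is the integral of
    \<open>\<bar>k\<bar>\<close> for every \<open>y\<close>, by translation invariance; the factors
    are swapped afterwards.\<close>
  interpret Q: pair_sigma_finite M lborel by standard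
  have i: "integrable lborel (\<lambda>x. k (x - y))" for y
    using lborel_integrable_real_affine[OF k_int, of 1 "-y"] by simp
  have e: "(\<integral>x. \<bar>k (x - y)\<bar> \<partial>lborel) = (\<integral>x. \<bar>k x\<bar> \<partial>lborel)" for y
    using lborel_integral_real_affine[of 1 "\<lambda>x. \<bar>k x\<bar>" "-y"] by simp
  have "integrable (M \<Otimes>\<^sub>M lborel) (\<lambda>(y,x). k (x - y))"
    by (rule Q.Fubini_integrable) (auto simp: i e)
  then show ?thesis using LM.integrable_product_swap_iff[of "\<lambda>(x,y). k (x - y)"] by simp
qed

lemma integrable_conv_mean: "integrable lborel m"
  using LM.integrable_fst'[OF integrable_pair] unfolding conv_mean_def by simp

text \<open>The convolution theorem: Fubini, then the translation of \<open>x\<close> by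
  \<open>y\<close> in the inner integral, which brings out \<open>cis (t * y)\<close>.\<close>

lemma charfun_K_conv_mean: "charfun_K m t = charfun_K k t * char M t"
proof -
  have i: "integrable (lborel \<Otimes>\<^sub>M M) (\<lambda>(x,y). cis (t * x) * complex_of_real (k (x - y)))"
    by (rule Bochner_Integration.integrable_bound[OF integrable_pair])
       (auto simp: norm_mult cis_conv_exp)
  have "charfun_K m t = (\<integral>x. (\<integral>y. cis (t * x) * complex_of_real (k (x - y)) \<partial>M) \<partial>lborel)"
    unfolding charfun_K_def conv_mean_def by simp
  also have "\<dots> = (\<integral>y. (\<integral>x. cis (t * x) * complex_of_real (k (x - y)) \<partial>lborel) \<partial>M)"
    using LM.Fubini_integral[OF i] by simp
  also have "\<dots> = (\<integral>y. cis (t * y) * charfun_K k t \<partial>M)"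
  proof (rule Bochner_Integration.integral_cong)
    fix y
    have "(\<integral>x. cis (t * x) * complex_of_real (k (x - y)) \<partial>lborel)
      = (\<integral>x. cis (t * y) * (cis (t * x) * complex_of_real (k x)) \<partial>lborel)"
      by (subst lborel_integral_real_affine[where c=1 and t=y]) (auto simp: algebra_simps cis_mult)
    then show "(\<integral>x. cis (t * x) * complex_of_real (k (x - y)) \<partial>lborel) = cis (t * y) * charfun_K k t"
      by (simp add: charfun_K_def)
  qed simp
  also have "\<dots> = charfun_K k t * char M t"
    by (simp add: char_def cis_conv_exp mult.commute)
  finally show ?thesis .
qed

end

section \<open>Cauchy-Schwarz and almost everywhere statements\<close>

lemma norm_integral_mult_sq_le:
  fixes D :: "real \<Rightarrow> real" and \<psi> :: "real \<Rightarrow> complex"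
  assumes [measurable]: "D \<in> borel_measurable borel" "\<psi> \<in> borel_measurable borel"
  shows "ennreal ((cmod (\<integral>x. D x * \<psi> x \<partial>lborel))\<^sup>2)
    \<le> (\<integral>\<^sup>+x. ennreal ((D x)\<^sup>2) \<partial>lborel) * (\<integral>\<^sup>+x. ennreal ((cmod (\<psi> x))\<^sup>2) \<partial>lborel)"
proof (cases "integrable lborel (\<lambda>x. D x * \<psi> x)")
  case True
  have "ennreal ((cmod (\<integral>x. D x * \<psi> x \<partial>lborel))\<^sup>2) = (ennreal (cmod (\<integral>x. D x * \<psi> x \<partial>lborel)))\<^sup>2"
    by (simp add: ennreal_power)
  also have "\<dots> \<le> (\<integral>\<^sup>+x. ennreal \<bar>D x\<bar> * ennreal (cmod (\<psi> x)) \<partial>lborel)\<^sup>2"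
    using integral_norm_bound_ennreal[OF True]
    by (intro power_mono) (auto simp: norm_mult ennreal_mult)
  also have "\<dots> \<le> (\<integral>\<^sup>+x. ennreal \<bar>D x\<bar> ^ 2 \<partial>lborel) * (\<integral>\<^sup>+x. ennreal (cmod (\<psi> x)) ^ 2 \<partial>lborel)"
    by (rule Cauchy_Schwarz_nn_integral) auto
  finally show ?thesis by (simp add: ennreal_power)
\<comment> \<open>Without integrability the Bochner integral is \<open>0\<close> by default, so the
  left side vanishes.\<close>
qed (simp add: not_integrable_integral_eq)

text \<open>A nonempty open set contains a ball, so it has positive measure and cannot lie inside
  the exceptional null set.\<close>

lemma AE_lborel_openD:
  fixes S :: "real set"
  assumes "AE x in lborel. P x" "open S" "x \<in> S"
  shows "\<exists>y\<in>S. P y"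
proof (rule ccontr)
  assume "\<not> (\<exists>y\<in>S. P y)"
  then have "AE x in lborel. x \<notin> S" using assms(1) by (auto elim!: eventually_mono)
  then have "emeasure lborel S = 0"
    using assms(2) by (subst (asm) AE_iff_measurable[where N=S]) auto
  moreover obtain e where "e > 0" "ball x e \<subseteq> S" using assms(2,3) open_contains_ball by blast
  then have "emeasure lborel (ball x e) \<le> emeasure lborel S"
    using assms(2) by (intro emeasure_mono) auto
  ultimately show False using \<open>e > 0\<close> by (simp add: ball_eq_greaterThanLessThan)
qed

lemma AE_lborel_isCont_zeroD:
  fixes f :: "real \<Rightarrow> real"
  assumes ae: "AE x in lborel. f x = 0" and cont: "\<And>x. isCont f x"
  shows "f x = 0"
proof (rule ccontr)
  assume "f x \<noteq> 0"
  moreover have "open {x. f x \<noteq> 0}"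
    using cont by (intro open_Collect_neq) (auto intro: continuous_at_imp_continuous_on)
  ultimately show False using AE_lborel_openD[OF ae] by blast
qed

lemma real_distribution_density:
  assumes [measurable]: "f \<in> borel_measurable borel" and "(\<integral>\<^sup>+x. f x \<partial>lborel) = 1"
  shows "real_distribution (density lborel f)"
  using assms by (intro real_distribution.intro prob_spaceI real_distribution_axioms.intro)
    (auto simp: emeasure_density)

subsection \<open>The Fejer density\<close>

definition unit_uniform :: "real measure" where
  "unit_uniform = density lborel (\<lambda>x. ennreal (indicator {0..1} x))"

text \<open>The triangular law on \<open>[-1, 1]\<close>: compactly supported, with a nonnegative
  characteristic function that will serve as the density.\<close>

definition unit_difference :: "real measure" where
  "unit_difference = distr (unit_uniform \<Otimes>\<^sub>M unit_uniform) borel (\<lambda>p. fst p - snd p)"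

interpretation U: real_distribution unit_uniform
  unfolding unit_uniform_def
  by (rule real_distribution_density) (auto simp: ennreal_indicator)

interpretation UU: pair_prob_space unit_uniform unit_uniform
  by standard

interpretation UD: real_distribution unit_difference
  unfolding unit_difference_def
  by (intro UU.prob_space_distr real_distribution_axioms.intro real_distribution.intro) auto

lemma AE_unit_uniform: "AE x in unit_uniform. 0 \<le> x \<and> x \<le> 1"
  unfolding unit_uniform_def by (subst AE_density) (auto simp: indicator_def)

lemma AE_unit_difference: "AE t in unit_difference. \<bar>t\<bar> \<le> 1"
proof -
  have "AE x in unit_uniform. AE y in unit_uniform. \<bar>x - y\<bar> \<le> 1"
    using AE_unit_uniform
  proof eventually_elim
    fix x :: real assume x: "0 \<le> x \<and> x \<le> 1"
    show "AE y in unit_uniform. \<bar>x - y\<bar> \<le> 1"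
      using AE_unit_uniform by eventually_elim (use x in auto)
  qed
  then have "AE p in unit_uniform \<Otimes>\<^sub>M unit_uniform. \<bar>fst p - snd p\<bar> \<le> 1"
  proof (intro UU.AE_pair_measure)
    have "Measurable.pred (borel \<Otimes>\<^sub>M borel) (\<lambda>p::real \<times> real. \<bar>fst p - snd p\<bar> \<le> 1)"
      by measurable
    then show "{p \<in> space (unit_uniform \<Otimes>\<^sub>M unit_uniform). \<bar>fst p - snd p\<bar> \<le> 1}
        \<in> sets (unit_uniform \<Otimes>\<^sub>M unit_uniform)"
      by (simp add: pred_def space_pair_measure)
  qed simp
  then show ?thesis
    unfolding unit_difference_def by (subst AE_distr_iff) (auto simp: case_prod_beta)
qed

lemma char_unit_difference: "char unit_difference x = complex_of_real ((cmod (char unit_uniform x))\<^sup>2)"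
proof -
  let ?e = "\<lambda>s. iexp (x * s)"
  have *: "iexp (x * (s - t)) = ?e s * cnj (?e t)" for s t
    by (simp add: exp_cnj exp_add[symmetric] right_diff_distrib)
  have i: "integrable (unit_uniform \<Otimes>\<^sub>M unit_uniform) (\<lambda>p. ?e (fst p) * cnj (?e (snd p)))"
    unfolding *[symmetric] by (rule UU.integrable_const_bound[where B=1]) auto
  have "char unit_difference x = (\<integral>p. iexp (x * (fst p - snd p)) \<partial>(unit_uniform \<Otimes>\<^sub>M unit_uniform))"
    unfolding char_def unit_difference_def by (subst integral_distr) (auto simp: case_prod_beta)
  also have "\<dots> = (\<integral>s. (\<integral>t. ?e s * cnj (?e t) \<partial>unit_uniform) \<partial>unit_uniform)"
    unfolding * UU.integral_fst'[OF i, symmetric] fst_conv snd_conv ..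
  also have "\<dots> = char unit_uniform x * cnj (char unit_uniform x)"
    unfolding char_def by (simp only: integral_mult_right_zero integral_mult_left_zero Bochner_Integration.integral_cnj)
  finally show ?thesis by (simp only: complex_norm_square)
qed

text \<open>The explicit antiderivative gives \<open>(exp (i x) - 1) / (i x)\<close>, whose
  numerator has modulus at most \<open>2\<close>. Squared, this is the decay that makes
  \<open>fejer\<close> integrable.\<close>

lemma cmod_char_unit_uniform_le:
  assumes x: "x \<noteq> 0"
  shows "cmod (char unit_uniform x) \<le> 2 / \<bar>x\<bar>"
proof -
  let ?c = "\<i> * complex_of_real x"
  have d: "((\<lambda>t. exp (?c * of_real t) / ?c) has_vector_derivative exp (?c * of_real t)) (at t within S)" for t S
    using x by (intro has_vector_derivative_real_field) (auto intro!: derivative_eq_intros)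
  have "char unit_uniform x = (\<integral>t. indicator {0..1} t *\<^sub>R exp (?c * of_real t) \<partial>lborel)"
    unfolding char_def unit_uniform_def by (subst integral_density) (auto simp: mult.assoc)
  also have "\<dots> = exp (?c * of_real 1) / ?c - exp (?c * of_real 0) / ?c"
    by (rule integral_FTC_atLeastAtMost) (auto intro!: d continuous_intros)
  finally have "cmod (char unit_uniform x) = cmod (exp (?c * of_real 1) - 1) / \<bar>x\<bar>"
    by (simp add: diff_divide_distrib[symmetric] norm_divide norm_mult)
  also have "cmod (exp (?c * of_real 1) - 1) \<le> cmod (exp (?c * of_real 1)) + cmod 1"
    by (rule norm_triangle_ineq4)
  also have "\<dots> = 2" by simp
  finally show ?thesis by (simp add: divide_right_mono)
qed

text \<open>Away from \<open>0\<close> this is \<open>(sin (x / 2) / (x / 2))\<^sup>2\<close>. As a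
  squared modulus it is the transform of \<open>unit_difference\<close>, hence band-limited.\<close>

definition fejer :: "real \<Rightarrow> real" where
  "fejer x = (cmod (char unit_uniform x))\<^sup>2"

lemma char_unit_difference_fejer: "char unit_difference x = complex_of_real (fejer x)"
  by (simp add: fejer_def char_unit_difference)

lemma isCont_fejer: "isCont fejer x"
  unfolding fejer_def by (intro continuous_intros U.isCont_char)

lemma fejer_measurable [measurable]: "fejer \<in> borel_measurable borel"
  unfolding fejer_def by measurable

lemma fejer_nonneg: "0 \<le> fejer x"
  by (simp add: fejer_def)

lemma fejer_0: "fejer 0 = 1"
  by (simp add: fejer_def U.char_zero)

lemma fejer_uminus: "fejer (- x) = fejer x"
proof -
  have "complex_of_real (fejer (- x)) = cnj (complex_of_real (fejer x))"
    unfolding char_unit_difference_fejer[symmetric] char_def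
    by (simp add: exp_cnj flip: Bochner_Integration.integral_cnj)
  then show ?thesis by simp
qed

lemma fejer_le: "fejer x \<le> 5 / (1 + x\<^sup>2)"
\<comment> \<open>The trivial bound \<open>1\<close>, the decay \<open>4 / x\<^sup>2\<close> and the
  target \<open>5 / (1 + x\<^sup>2)\<close> all agree at \<open>x\<^sup>2 = 4\<close>; hence the
  split and the constant \<open>5\<close>.\<close>
proof (cases "x\<^sup>2 \<le> 4")
  case True
  have "fejer x \<le> 1"
    using U.cmod_char_le_1[of x] by (simp add: fejer_def power_le_one)
  also have "1 \<le> 5 / (1 + x\<^sup>2)" using True by (simp add: add_pos_nonneg)
  finally show ?thesis .
next
  case False
  then have "x \<noteq> 0" by auto
  then have "fejer x \<le> (2 / \<bar>x\<bar>)\<^sup>2"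
    unfolding fejer_def by (intro power_mono cmod_char_unit_uniform_le) auto
  also have "\<dots> = 4 / x\<^sup>2" by (simp add: power_divide)
  also have "\<dots> \<le> 5 / (1 + x\<^sup>2)" using False by (simp add: divide_simps add_pos_nonneg)
  finally show ?thesis .
qed

lemma integrable_fejer: "integrable lborel fejer"
proof (rule Bochner_Integration.integrable_bound)
  have "integrable lborel (\<lambda>x::real. inverse (1 + x\<^sup>2))"
    using integrable_inverse_1_plus_square by (simp add: set_integrable_def)
  then show "integrable lborel (\<lambda>x::real. 5 * inverse (1 + x\<^sup>2))" by simp
qed (use fejer_le fejer_nonneg in \<open>auto simp: divide_inverse\<close>)

lemma integral_fejer_pos: "0 < (\<integral>x. fejer x \<partial>lborel)"
proof -
  have "(\<integral>x. fejer x \<partial>lborel) \<noteq> 0"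
  proof
    assume "(\<integral>x. fejer x \<partial>lborel) = 0"
    then have ae: "AE x in lborel. fejer x = 0"
      using integral_nonneg_eq_0_iff_AE[OF integrable_fejer] fejer_nonneg by simp
    have "fejer 0 = 0"
      by (rule AE_lborel_isCont_zeroD[OF ae isCont_fejer])
    then show False by (simp add: fejer_0)
  qed
  then show ?thesis using fejer_nonneg by (simp add: less_le)
qed

subsection \<open>The risk of the kernel density estimator\<close>

definition scaled_kernel :: "(real \<Rightarrow> real) \<Rightarrow> real \<Rightarrow> real \<Rightarrow> real" where
  "scaled_kernel K h x = K (x / h) / h"

lemma std_kernel_measurable: "std_kernel K \<Longrightarrow> K \<in> borel_measurable borel"
  unfolding std_kernel_def by auto

lemma integral_std_kernel_sq_pos:
  assumes "std_kernel K"
  shows "0 < (\<integral>x. (K x)\<^sup>2 \<partial>lborel)"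
proof -
  have "(\<integral>x. (K x)\<^sup>2 \<partial>lborel) \<noteq> 0"
  proof
    assume "(\<integral>x. (K x)\<^sup>2 \<partial>lborel) = 0"
    then have "AE x in lborel. (K x)\<^sup>2 = 0"
      using assms by (subst (asm) integral_nonneg_eq_0_iff_AE) (auto simp: std_kernel_def)
    then have "AE x in lborel. K x = 0" by simp
    then have "(\<integral>x. K x \<partial>lborel) = 0" by (rule integral_eq_zero_AE)
    then show False using assms by (simp add: std_kernel_def)
  qed
  then show ?thesis by (simp add: less_le)
qed

lemma nn_integral_scaled_kernel_sq:
  assumes K: "std_kernel K" and h: "h > 0"
  shows "(\<integral>\<^sup>+x. ennreal ((scaled_kernel K h x)\<^sup>2) \<partial>lborel) = ennreal ((\<integral>x. (K x)\<^sup>2 \<partial>lborel) / h)"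
proof -
  have [measurable]: "K \<in> borel_measurable borel" by (rule std_kernel_measurable[OF K])
  have "(\<integral>\<^sup>+x. ennreal ((scaled_kernel K h x)\<^sup>2) \<partial>lborel)
    = ennreal h * (\<integral>\<^sup>+x. ennreal ((K x)\<^sup>2 / h\<^sup>2) \<partial>lborel)"
    unfolding scaled_kernel_def using h
    by (subst nn_integral_real_affine[where c=h and t=0]) (auto simp: power_divide)
  also have "(\<integral>\<^sup>+x. ennreal ((K x)\<^sup>2 / h\<^sup>2) \<partial>lborel) = ennreal (\<integral>x. (K x)\<^sup>2 / h\<^sup>2 \<partial>lborel)"
    using K h by (intro nn_integral_eq_integral) (auto simp: std_kernel_def)
  also have "ennreal h * \<dots> = ennreal ((\<integral>x. (K x)\<^sup>2 \<partial>lborel) / h)"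
    using h by (simp add: ennreal_mult[symmetric] power2_eq_square)
  finally show ?thesis .
qed

lemma charfun_K_scaled_kernel:
  assumes h: "h > 0"
  shows "charfun_K (scaled_kernel K h) t = charfun_K K (h * t)"
  unfolding charfun_K_def scaled_kernel_def
  using h by (subst lborel_integral_real_affine[where c=h and t=0]) (auto simp: scaleR_conv_of_real ac_simps)

lemma integrable_scaled_kernel:
  assumes K: "std_kernel K" and h: "h > 0"
  shows "integrable lborel (scaled_kernel K h)"
  using lborel_integrable_real_affine[of K "1/h" 0] K h
  unfolding scaled_kernel_def std_kernel_def by simp

lemma real_distribution_prob_density: "prob_density f \<Longrightarrow> real_distribution (density lborel f)"
  unfolding prob_density_def by (intro real_distribution_density) auto

lemma integrable_kernel_mean_scaled:
  assumes K: "std_kernel K" and f: "prob_density f" and h: "h > 0"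
  obtains b where "integrable_kernel_mean (density lborel f) (scaled_kernel K h) b"
proof -
  have [measurable]: "K \<in> borel_measurable borel" by (rule std_kernel_measurable[OF K])
  obtain b where b: "\<And>x. \<bar>K x\<bar> \<le> b" using K by (auto simp: std_kernel_def bounded_iff)
  interpret real_distribution "density lborel f" by (rule real_distribution_prob_density[OF f])
  have "integrable_kernel_mean (density lborel f) (scaled_kernel K h) (b / h)"
    using b h integrable_scaled_kernel[OF K h]
    by unfold_locales (auto simp: scaled_kernel_def[abs_def] abs_divide divide_right_mono)
  then show ?thesis by (rule that)
qed

lemma prob_density_measurable: "prob_density f \<Longrightarrow> f \<in> borel_measurable borel"
  unfolding prob_density_def by auto

lemma MISE_eq:
  assumes K: "std_kernel K" and f: "prob_density f" and h: "h > 0" and n: "n > 0"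
  shows "MISE n f K h = int_var (density lborel f) (scaled_kernel K h) / ennreal (real n)
    + int_sq_bias (density lborel f) (scaled_kernel K h) f"
proof -
  obtain b where "integrable_kernel_mean (density lborel f) (scaled_kernel K h) b"
    by (rule integrable_kernel_mean_scaled[OF K f h])
  then interpret integrable_kernel_mean "density lborel f" "scaled_kernel K h" b .
  show ?thesis
    using mean_integrated_sq_error[OF prob_density_measurable[OF f] n]
    by (simp add: MISE_def kde_def sample_law_def scaled_kernel_def)
qed

lemma int_var_add_sq_mean_scaled:
  assumes K: "std_kernel K" and f: "prob_density f" and h: "h > 0"
  shows "int_var (density lborel f) (scaled_kernel K h)
      + (\<integral>\<^sup>+x. ennreal ((conv_mean (density lborel f) (scaled_kernel K h) x)\<^sup>2) \<partial>lborel)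
    = ennreal ((\<integral>x. (K x)\<^sup>2 \<partial>lborel) / h)"
proof -
  obtain b where "integrable_kernel_mean (density lborel f) (scaled_kernel K h) b"
    by (rule integrable_kernel_mean_scaled[OF K f h])
  then interpret integrable_kernel_mean "density lborel f" "scaled_kernel K h" b .
  show ?thesis using int_var_add_sq_mean nn_integral_scaled_kernel_sq[OF K h] by simp
qed

text \<open>The kernel-free lower bound for variance plus squared bias: the variance of
  \<open>f (u + X)\<close>, with \<open>X\<close> of density \<open>f\<close>, integrated over
  \<open>u\<close>.\<close>

definition shift_var :: "(real \<Rightarrow> real) \<Rightarrow> ennreal" where
  "shift_var f = (\<integral>\<^sup>+u. ennreal (\<integral>y. (f (u + y) - (\<integral>y. f (u + y) \<partial>density lborel f))\<^sup>2
     \<partial>density lborel f) \<partial>lborel)"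

lemma Phi_ge:
  assumes K: "std_kernel K" and f: "prob_density f" and c: "\<And>x. \<bar>f x\<bar> \<le> c" and n: "n > 0"
  shows "shift_var f / ennreal (real n) \<le> Phi n f K"
  unfolding Phi_def
proof (rule INF_greatest)
  fix h :: real assume "h \<in> {0<..}"
  then have h: "h > 0" by simp
  obtain b where "integrable_kernel_mean (density lborel f) (scaled_kernel K h) b"
    by (rule integrable_kernel_mean_scaled[OF K f h])
  then interpret integrable_kernel_mean "density lborel f" "scaled_kernel K h" b .
  let ?V = "int_var (density lborel f) (scaled_kernel K h)"
  let ?B = "int_sq_bias (density lborel f) (scaled_kernel K h) f"
  have "shift_var f \<le> ?V + ?B"
    unfolding shift_var_def by (rule int_var_add_bias_ge[OF prob_density_measurable[OF f] c])
  then have "shift_var f / ennreal (real n) \<le> (?V + ?B) / ennreal (real n)"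
    by (rule divide_right_mono_ennreal)
  also have "\<dots> = ?V / ennreal (real n) + ?B / ennreal (real n)"
    by (rule add_divide_distrib_ennreal)
  \<comment> \<open>As \<open>n \<ge> 1\<close>, the undivided bias in the risk dominates the
    divided one.\<close>
  also have "?B / ennreal (real n) \<le> ?B"
    using n mult_left_mono[of "inverse (ennreal (real n))" 1 ?B]
    by (simp add: divide_ennreal_def inverse_ennreal inverse_le_1_iff ennreal_le_1)
  finally show "shift_var f / ennreal (real n) \<le> MISE n f K h"
    unfolding MISE_eq[OF K f h n] by (simp add: add_left_mono)
qed

section \<open>Exact order for the Fejer density\<close>

definition fejer_density :: "real \<Rightarrow> real" where
  "fejer_density x = fejer x / (\<integral>x. fejer x \<partial>lborel)"

lemma isCont_fejer_density: "isCont fejer_density x"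
  unfolding fejer_density_def using integral_fejer_pos by (intro continuous_intros isCont_fejer) auto

lemma fejer_density_measurable [measurable]: "fejer_density \<in> borel_measurable borel"
  unfolding fejer_density_def by measurable

lemma fejer_density_nonneg: "0 \<le> fejer_density x"
  using integral_fejer_pos fejer_nonneg by (simp add: fejer_density_def)

lemma fejer_density_0_pos: "0 < fejer_density 0"
  using integral_fejer_pos by (simp add: fejer_density_def fejer_0)

lemma prob_density_fejer: "prob_density fejer_density"
proof -
  have "(\<integral>\<^sup>+x. ennreal (fejer_density x) \<partial>lborel) = ennreal (\<integral>x. fejer_density x \<partial>lborel)"
    using integrable_fejer fejer_density_nonneg unfolding fejer_density_def
    by (intro nn_integral_eq_integral) auto
  then show ?thesis
    using integral_fejer_pos fejer_density_nonneg
    by (auto simp: prob_density_def fejer_density_def[abs_def])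
qed

lemma fejer_density_le: "\<bar>fejer_density x\<bar> \<le> fejer_density 0"
proof -
  have "fejer x \<le> 1"
    unfolding fejer_def by (intro power_le_one U.cmod_char_le_1) auto
  then show ?thesis
    using fejer_nonneg[of x] integral_fejer_pos
    by (auto simp: fejer_density_def fejer_0 divide_right_mono)
qed

lemma L2_fejer_density: "L2 fejer_density"
proof -
  have "integrable lborel (\<lambda>x. (fejer_density x)\<^sup>2)"
  proof (rule Bochner_Integration.integrable_bound)
    show "integrable lborel (\<lambda>x. fejer_density 0 * fejer_density x)"
      using integrable_fejer by (simp add: fejer_density_def[abs_def])
  qed (use fejer_density_le fejer_density_nonneg in
        \<open>auto simp: power2_eq_square abs_mult intro!: AE_I2 mult_right_mono\<close>)
  then show ?thesis by (simp add: L2_def)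
qed

text \<open>Were it zero, then for almost every \<open>u\<close> the function
  \<open>y \<mapsto> f (u + y)\<close> would be constant where \<open>f y > 0\<close>. For a
  \<open>u\<close> with \<open>0 < f u < f 0\<close>, the points \<open>y = 0\<close> and
  \<open>y = - u\<close> both qualify, the latter by symmetry, and force
  \<open>f u = f 0\<close>.\<close>

lemma shift_var_fejer_pos: "0 < shift_var fejer_density"
proof (rule ccontr)
  let ?f = fejer_density
  let ?M = "density lborel ?f"
  let ?mu = "\<lambda>u. \<integral>y. ?f (u + y) \<partial>?M"
  interpret M: real_distribution ?M by (rule real_distribution_prob_density[OF prob_density_fejer])
  assume "\<not> 0 < shift_var ?f"
  then have "AE u in lborel. ennreal (\<integral>y. (?f (u + y) - ?mu u)\<^sup>2 \<partial>?M) = 0"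
    unfolding shift_var_def by (subst nn_integral_0_iff_AE[symmetric]) auto
  then have ae: "AE u in lborel. (\<integral>y. (?f (u + y) - ?mu u)\<^sup>2 \<partial>?M) = 0"
    by eventually_elim (simp add: ennreal_eq_0_iff antisym)
  \<comment> \<open>The bound \<open>5 / (1 + x\<^sup>2)\<close> is \<open>1 / 2\<close> at
    \<open>x = 3\<close>; the intermediate value \<open>f 0 / 2\<close> shows that the open set of
    admissible \<open>u\<close> is nonempty.\<close>
  have "?f 3 \<le> ?f 0 / 2"
    using fejer_le[of 3] integral_fejer_pos by (simp add: fejer_density_def fejer_0 field_simps)
  then obtain v where v: "?f v = ?f 0 / 2"
    using IVT2'[of ?f 3 "?f 0 / 2" 0] fejer_density_0_pos isCont_fejer_density
    by (auto intro: continuous_at_imp_continuous_on)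
  have "open (?f -` {0<..<?f 0})"
    using isCont_fejer_density by (intro continuous_open_vimage) auto
  then obtain u where u: "0 < ?f u" "?f u < ?f 0" "(\<integral>y. (?f (u + y) - ?mu u)\<^sup>2 \<partial>?M) = 0"
    using AE_lborel_openD[OF ae, of "?f -` {0<..<?f 0}" v] v fejer_density_0_pos by auto
  \<comment> \<open>Absorbing the density gives a continuous integrand for Lebesgue measure, so that
    vanishing almost everywhere becomes vanishing everywhere.\<close>
  define g where "g y = ?f y * (?f (u + y) - ?mu u)\<^sup>2" for y
  have "integrable ?M (\<lambda>y. (?f (u + y) - ?mu u)\<^sup>2)"
  proof (rule M.integrable_bounded_borel[where b="(?f 0 + \<bar>?mu u\<bar>)\<^sup>2"])
    fix x
    have "\<bar>?f (u + x) - ?mu u\<bar> \<le> \<bar>?f 0 + \<bar>?mu u\<bar>\<bar>"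
      using fejer_density_le[of "u + x"] fejer_density_0_pos by linarith
    then show "\<bar>(?f (u + x) - ?mu u)\<^sup>2\<bar> \<le> (?f 0 + \<bar>?mu u\<bar>)\<^sup>2"
      unfolding abs_power2 by (simp only: abs_le_square_iff)
  qed simp
  then have "integrable lborel g"
    unfolding g_def by (subst (asm) integrable_density) (auto simp: fejer_density_nonneg)
  moreover have "(\<integral>y. g y \<partial>lborel) = 0"
    using u(3) unfolding g_def by (subst (asm) integral_density) (auto simp: fejer_density_nonneg)
  ultimately have ae_g: "AE y in lborel. g y = 0"
    by (subst (asm) integral_nonneg_eq_0_iff_AE) (auto simp: g_def fejer_density_nonneg)
  have "isCont g y" for y
    unfolding g_def by (intro continuous_intros isCont_o2[OF _ isCont_fejer_density] isCont_fejer_density)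
  then have g: "g y = 0" for y by (rule AE_lborel_isCont_zeroD[OF ae_g])
  have "?f (- u) = ?f u" by (simp add: fejer_density_def fejer_uminus)
  then have "?f 0 = ?mu u" "?f u = ?mu u"
    using g[of "- u"] g[of 0] u(1) fejer_density_0_pos by (auto simp: g_def)
  then show False using u(2) by simp
qed

text \<open>Scaling turns \<open>[0, h]\<close> into \<open>[0, 1]\<close> and conjugation adds
  \<open>[-1, 0]\<close>, so the transform of the scaled kernel is one on the support of
  \<open>unit_difference\<close>; convolution then reproduces \<open>fejer\<close>.\<close>

lemma conv_mean_fejer_density:
  assumes K: "std_kernel K" and h: "h > 0" and one: "\<And>t. 0 \<le> t \<Longrightarrow> t \<le> h \<Longrightarrow> charfun_K K t = 1"
  shows "conv_mean (density lborel fejer_density) (scaled_kernel K h) x = fejer_density x"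
proof -
  let ?k = "scaled_kernel K h" and ?c = "\<integral>x. fejer x \<partial>lborel"
  have [measurable]: "K \<in> borel_measurable borel" by (rule std_kernel_measurable[OF K])
  then have [measurable]: "?k \<in> borel_measurable borel" by (simp add: scaled_kernel_def[abs_def])
  have "AE t in unit_difference. charfun_K ?k t = 1"
    using AE_unit_difference
  proof eventually_elim
    fix t :: real assume t: "\<bar>t\<bar> \<le> 1"
    have "charfun_K K (h * \<bar>t\<bar>) = 1" using t h by (intro one) (auto simp: mult_left_le)
    moreover have "h * t = h * \<bar>t\<bar> \<or> h * t = - (h * \<bar>t\<bar>)" by (auto simp: abs_if)
    ultimately show "charfun_K ?k t = 1"
      using h charfun_K_uminus[of K "h * \<bar>t\<bar>"] by (auto simp: charfun_K_scaled_kernel)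
  qed
  then have "(\<integral>y. complex_of_real (?k (x - y) * fejer y) \<partial>lborel) = complex_of_real (fejer x)"
    using UD.integral_mult_char_reflect[OF integrable_scaled_kernel[OF K h]]
    by (simp add: char_unit_difference_fejer)
  then have *: "(\<integral>y. ?k (x - y) * fejer y \<partial>lborel) = fejer x"
    by (subst (asm) integral_complex_of_real) simp
  have "conv_mean (density lborel fejer_density) ?k x = (\<integral>y. ?k (x - y) * fejer y / ?c \<partial>lborel)"
    unfolding conv_mean_def
    by (subst integral_density) (auto simp: fejer_density_nonneg, simp add: fejer_density_def mult.commute)
  then show ?thesis by (simp add: * fejer_density_def)
qed

lemma exact_order_fejer_density:
  assumes K: "std_kernel K" and S: "0 < S_K K"
  shows "exact_order_inv_n (\<lambda>n. Phi n fejer_density K)"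
proof -
  \<comment> \<open>Half of \<open>S_K K\<close> lies strictly below the infimum, so the transform
    is one on all of \<open>[0, h]\<close>, endpoint included.\<close>
  define h where "h = S_K K / 2"
  have h: "h > 0" using S by (simp add: h_def)
  have one: "charfun_K K t = 1" if "0 \<le> t" "t \<le> h" for t
  proof (rule ccontr)
    assume "charfun_K K t \<noteq> 1"
    then have "S_K K \<le> t" unfolding S_K_def using that
      by (intro cInf_lower) (auto intro!: bdd_belowI[of _ 0])
    then show False using that S by (simp add: h_def)
  qed
  let ?V = "int_var (density lborel fejer_density) (scaled_kernel K h)"
  define C where "C = (\<integral>x. (K x)\<^sup>2 \<partial>lborel) / h"
  have C: "C > 0" using integral_std_kernel_sq_pos[OF K] h by (simp add: C_def)
  have V: "?V \<le> ennreal C"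
    using int_var_add_sq_mean_scaled[OF K prob_density_fejer h, symmetric] by (simp add: C_def)
  have upper: "Phi n fejer_density K \<le> ennreal (C / real n)" if n: "n > 0" for n
  proof -
    have "Phi n fejer_density K \<le> MISE n fejer_density K h"
      unfolding Phi_def using h by (intro INF_lower) auto
    also have "\<dots> = ?V / ennreal (real n)"
      by (subst MISE_eq[OF K prob_density_fejer h n])
         (simp add: int_sq_bias_def conv_mean_fejer_density[OF K h one])
    also have "\<dots> \<le> ennreal C / ennreal (real n)" by (intro divide_right_mono_ennreal V)
    finally show ?thesis using n C by (simp add: divide_ennreal)
  qed
  \<comment> \<open>The minimum with \<open>1\<close> keeps the value finite, since
    \<open>enn2real\<close> would send infinity to \<open>0\<close>.\<close>
  define L where "L = enn2real (min (shift_var fejer_density) 1)"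
  have L: "L > 0" "ennreal L \<le> shift_var fejer_density"
    using shift_var_fejer_pos unfolding L_def
    by (auto simp: enn2real_positive_iff min_less_iff_disj)
  have lower: "ennreal (min L C / real n) \<le> Phi n fejer_density K" if n: "n > 0" for n
  proof -
    have "ennreal (min L C / real n) = ennreal (min L C) / ennreal (real n)"
      using n L C by (simp add: divide_ennreal)
    also have "\<dots> \<le> shift_var fejer_density / ennreal (real n)"
      by (intro divide_right_mono_ennreal order.trans[OF _ L(2)] ennreal_leI) simp
    also have "\<dots> \<le> Phi n fejer_density K"
      by (rule Phi_ge[OF K prob_density_fejer fejer_density_le n])
    finally show ?thesis .
  qed
  \<comment> \<open>The minimum secures \<open>c \<le> C\<close>, and starting at \<open>1\<close>
    excludes division by zero.\<close>
  show ?thesis unfolding exact_order_inv_n_def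
    using L C upper lower by (intro exI[of _ "min L C"] exI[of _ C] exI[of _ 1]) auto
qed

subsection \<open>Bandwidths with risk of order \<open>1 / n\<close>\<close>

text \<open>Times \<open>b\<close>, the mean is the integral of \<open>w\<close> over
  \<open>[0, b]\<close>; so the primitive of \<open>w\<close> vanishes identically, and with it its
  derivative \<open>w\<close>.\<close>

lemma continuous_eq_0_of_rescaled_means:
  fixes w :: "real \<Rightarrow> complex"
  assumes cont: "\<And>t. isCont w t" and mean: "\<And>b. 0 < b \<Longrightarrow> (\<integral>t. w (b * t) \<partial>unit_uniform) = 0"
    and t: "0 \<le> t"
  shows "w t = 0"
proof -
  have w: "continuous_on A w" for A
    using cont by (intro continuous_at_imp_continuous_on) auto
  have [measurable]: "w \<in> borel_measurable borel"
    by (intro borel_measurable_continuous_onI w)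
  have int0: "integral {0..b} w = 0" if "0 \<le> b" for b
  proof (cases "b = 0")
    case False
    then have b: "b > 0" using that by simp
    have "set_integrable lborel {0..b} w"
      by (intro borel_integrable_atLeastAtMost' w)
    then have "integral {0..b} w = (\<integral>t. indicator {0..b} t *\<^sub>R w t \<partial>lborel)"
      by (simp add: set_borel_integral_eq_integral(2)[symmetric] set_lebesgue_integral_def)
    also have "\<dots> = b *\<^sub>R (\<integral>t. indicator {0..b} (b * t) *\<^sub>R w (b * t) \<partial>lborel)"
      using b by (subst lborel_integral_real_affine[where c=b and t=0]) auto
    also have "(\<integral>t. indicator {0..b} (b * t) *\<^sub>R w (b * t) \<partial>lborel)
      = (\<integral>t. indicator {0..1} t *\<^sub>R w (b * t) \<partial>lborel)"
      using b by (intro Bochner_Integration.integral_cong) (auto simp: indicator_def zero_le_mult_iff mult_le_cancel_left1)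
    also have "\<dots> = (\<integral>t. w (b * t) \<partial>unit_uniform)"
      unfolding unit_uniform_def by (subst integral_density) auto
    finally show ?thesis using mean[OF b] by simp
  qed simp
  \<comment> \<open>The interval reaches beyond \<open>t\<close> so that it is nondegenerate even
    for \<open>t = 0\<close>, where the derivative is one-sided.\<close>
  have "((\<lambda>u. integral {0..u} w) has_vector_derivative w t) (at t within {0..t+1})"
    using t by (intro integral_has_vector_derivative w) auto
  then have "((\<lambda>u. 0) has_vector_derivative w t) (at t within {0..t+1})"
    by (rule has_vector_derivative_transform[rotated 2]) (use t int0 in auto)
  moreover have "((\<lambda>u. 0) has_vector_derivative 0) (at t within {0..t+1})" by simp
  ultimately show ?thesis
    using t by (intro vector_derivative_unique_within_closed_interval[of 0 "t+1" t "\<lambda>u. 0"]) auto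
qed

text \<open>Otherwise the Fejer density is reproduced at every bandwidth, and its squared norm is at
  most the integral of \<open>K\<^sup>2\<close> over \<open>h\<close> for arbitrarily large
  \<open>h\<close>.\<close>

lemma ex_charfun_K_neq_1:
  assumes K: "std_kernel K"
  shows "\<exists>t\<ge>0. charfun_K K t \<noteq> 1"
proof (rule ccontr)
  assume "\<not> ?thesis"
  then have one: "charfun_K K t = 1" if "0 \<le> t" for t using that by auto
  let ?F = "\<integral>\<^sup>+x. ennreal ((fejer_density x)\<^sup>2) \<partial>lborel"
  let ?K2 = "\<integral>x. (K x)\<^sup>2 \<partial>lborel"
  define F where "F = (\<integral>x. (fejer_density x)\<^sup>2 \<partial>lborel)"
  have iF: "integrable lborel (\<lambda>x. (fejer_density x)\<^sup>2)" using L2_fejer_density by (simp add: L2_def)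
  have F: "?F = ennreal F" unfolding F_def using iF by (intro nn_integral_eq_integral) auto
  have "F \<noteq> 0"
  proof
    assume "F = 0"
    then have "AE x in lborel. (fejer_density x)\<^sup>2 = 0"
      unfolding F_def using integral_nonneg_eq_0_iff_AE[OF iF] by simp
    then have "AE x in lborel. fejer_density x = 0" by simp
    then have "fejer_density 0 = 0"
      by (rule AE_lborel_isCont_zeroD) (rule isCont_fejer_density)
    then show False using fejer_density_0_pos by simp
  qed
  moreover have "0 \<le> F" by (simp add: F_def)
  ultimately have F_pos: "F > 0" by simp
  have *: "F \<le> ?K2 / h" if h: "h > 0" for h
  proof -
    have "ennreal F \<le> ennreal (?K2 / h)"
      unfolding F[symmetric] int_var_add_sq_mean_scaled[OF K prob_density_fejer h, symmetric]
      by (simp add: conv_mean_fejer_density[OF K h one])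
    then show ?thesis using integral_std_kernel_sq_pos[OF K] h by (simp add: ennreal_le_iff)
  qed
  \<comment> \<open>This bandwidth would give \<open>F \<le> F / 2\<close>.\<close>
  show False
    using *[of "2 * ?K2 / F"] integral_std_kernel_sq_pos[OF K] F_pos by (simp add: field_simps)
qed

lemma nn_integral_cmod_char_unit_uniform_sq:
  assumes b: "b > 0"
  shows "(\<integral>\<^sup>+x. ennreal ((cmod (char unit_uniform (b * x)))\<^sup>2) \<partial>lborel)
    = ennreal ((\<integral>x. fejer x \<partial>lborel) / b)"
proof -
  have "ennreal (\<integral>x. fejer x \<partial>lborel) = (\<integral>\<^sup>+x. ennreal (fejer x) \<partial>lborel)"
    using integrable_fejer fejer_nonneg by (intro nn_integral_eq_integral[symmetric]) auto
  also have "\<dots> = ennreal b * (\<integral>\<^sup>+x. ennreal (fejer (b * x)) \<partial>lborel)"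
    using b by (subst nn_integral_real_affine[where c=b and t=0]) auto
  finally have "ennreal (\<integral>x. fejer x \<partial>lborel) = ennreal b * (\<integral>\<^sup>+x. ennreal (fejer (b * x)) \<partial>lborel)" .
  then have "ennreal (1 / b) * ennreal (\<integral>x. fejer x \<partial>lborel)
      = (ennreal (1 / b) * ennreal b) * (\<integral>\<^sup>+x. ennreal (fejer (b * x)) \<partial>lborel)"
    by (simp only: mult.assoc)
  then show ?thesis
    using b integral_fejer_pos by (simp add: ennreal_mult[symmetric] fejer_def)
qed

text \<open>Testing the bias \<open>K\<^sub>h * f - f\<close> against the square integrable function
  \<open>x \<mapsto> char unit_uniform (b x)\<close> controls averages of its Fourier transform without Plancherel.\<close>

lemma mean_charfun_K_le_bias:
  assumes K: "std_kernel K" and f: "prob_density f" and h: "h > 0" and b: "b > 0"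
  shows "ennreal ((cmod (\<integral>t. (charfun_K K (h * (b * t)) - 1) * char (density lborel f) (b * t) \<partial>unit_uniform))\<^sup>2)
    \<le> int_sq_bias (density lborel f) (scaled_kernel K h) f * ennreal ((\<integral>x. fejer x \<partial>lborel) / b)"
proof -
  obtain B where "integrable_kernel_mean (density lborel f) (scaled_kernel K h) B"
    by (rule integrable_kernel_mean_scaled[OF K f h])
  then interpret integrable_kernel_mean "density lborel f" "scaled_kernel K h" B .
  \<comment> \<open>The law of \<open>b\<close> times a uniform variable: its characteristic
    function is the test function, so the multiplication formula applies to the bias.\<close>
  let ?N = "distr unit_uniform borel (\<lambda>t. b * t)"
  interpret N: real_distribution ?N
    by (intro U.prob_space_distr real_distribution_axioms.intro real_distribution.intro) auto
  have [measurable]: "f \<in> borel_measurable borel" by (rule prob_density_measurable[OF f])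
  have nonneg: "\<And>x. 0 \<le> f x" and "(\<integral>\<^sup>+x. ennreal (f x) \<partial>lborel) = 1"
    using f by (auto simp: prob_density_def)
  then have f_int: "integrable lborel f" by (intro integrableI_nonneg) auto
  let ?D = "\<lambda>x. m x - f x"
  have D: "integrable lborel ?D" using integrable_conv_mean f_int by simp
  have phi: "charfun_K ?D t = (charfun_K K (h * t) - 1) * char (density lborel f) t" for t
    using charfun_K_diff[OF integrable_conv_mean f_int, of t] charfun_K_conv_mean[of t] nonneg
    by (simp add: charfun_K_density charfun_K_scaled_kernel[OF h] left_diff_distrib)
  have char_N: "char ?N x = char unit_uniform (b * x)" for x
    unfolding char_def by (subst integral_distr) (auto simp: ac_simps)
  have "(\<integral>x. ?D x * char unit_uniform (b * x) \<partial>lborel) = (\<integral>t. charfun_K ?D t \<partial>?N)"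
    using N.multiplication_formula[OF D] by (simp add: char_N)
  also have "\<dots> = (\<integral>t. charfun_K ?D (b * t) \<partial>unit_uniform)"
    using D by (intro integral_distr) auto
  finally have *: "(\<integral>t. (charfun_K K (h * (b * t)) - 1) * char (density lborel f) (b * t) \<partial>unit_uniform)
    = (\<integral>x. ?D x * char unit_uniform (b * x) \<partial>lborel)"
    unfolding phi by simp
  show ?thesis
    unfolding * int_sq_bias_def nn_integral_cmod_char_unit_uniform_sq[OF b, symmetric]
    by (rule norm_integral_mult_sq_le) auto
qed

lemma S_K_pos_of_local:
  assumes K: "std_kernel K" and r: "r > 0" and one: "\<And>t. 0 \<le> t \<Longrightarrow> t < r \<Longrightarrow> charfun_K K t = 1"
  shows "S_K K > 0"
proof -
  have "r \<le> S_K K" unfolding S_K_def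
  proof (rule cInf_greatest)
    \<comment> \<open>The infimum of the empty set would carry no information.\<close>
    show "{t. 0 \<le> t \<and> cmod (charfun_K K t - 1) \<noteq> 0} \<noteq> {}"
      using ex_charfun_K_neq_1[OF K] by auto
  qed (use one in force)
  then show ?thesis using r by simp
qed

section \<open>Confining the bandwidths to a compact interval\<close>

lemma two_power2_add_le: "(x::real)\<^sup>2 \<le> 2 * (x - y)\<^sup>2 + 2 * y\<^sup>2"
  \<comment> \<open>The two sides differ by \<open>(x - 2 * y)\<^sup>2\<close>.\<close>
  using zero_le_power2[of "x - 2 * y"] by (simp add: power2_eq_square algebra_simps)

lemma nn_integral_sq_le:
  fixes f g :: "real \<Rightarrow> real"
  assumes [measurable]: "f \<in> borel_measurable borel" "g \<in> borel_measurable borel"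
  shows "(\<integral>\<^sup>+x. ennreal ((f x)\<^sup>2) \<partial>lborel)
    \<le> 2 * (\<integral>\<^sup>+x. ennreal ((f x - g x)\<^sup>2) \<partial>lborel) + 2 * (\<integral>\<^sup>+x. ennreal ((g x)\<^sup>2) \<partial>lborel)"
proof -
  have "ennreal ((f x)\<^sup>2) \<le> 2 * ennreal ((f x - g x)\<^sup>2) + 2 * ennreal ((g x)\<^sup>2)" for x
    using ennreal_leI[OF two_power2_add_le[of "f x" "g x"]]
    by (simp add: ennreal_mult)
  then have "(\<integral>\<^sup>+x. ennreal ((f x)\<^sup>2) \<partial>lborel)
    \<le> (\<integral>\<^sup>+x. 2 * ennreal ((f x - g x)\<^sup>2) + 2 * ennreal ((g x)\<^sup>2) \<partial>lborel)"
    by (intro nn_integral_mono) auto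
  also have "\<dots> = 2 * (\<integral>\<^sup>+x. ennreal ((f x - g x)\<^sup>2) \<partial>lborel) + 2 * (\<integral>\<^sup>+x. ennreal ((g x)\<^sup>2) \<partial>lborel)"
    by (simp add: nn_integral_add nn_integral_cmult)
  finally show ?thesis .
qed

text \<open>The risk bound gives \<open>V \<le> C\<close> and \<open>B \<le> C / n \<le> C\<close>.
  Comparing the squared norms of \<open>m\<close> and \<open>f\<close> both ways in
  \<open>V + \<integral>m\<^sup>2 = K2 / h\<close> yields an upper bound on \<open>K2 / h\<close>,
  keeping \<open>h\<close> away from \<open>0\<close>, and a lower one, keeping \<open>h\<close>
  bounded.\<close>

lemma MISE_bounds:
  assumes K: "std_kernel K" and f: "prob_density f" "L2 f" and h: "h > 0" and n: "n > 0" and C: "0 \<le> C"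
    and M: "MISE n f K h \<le> ennreal (C / real n)"
  defines "K2 \<equiv> \<integral>x. (K x)\<^sup>2 \<partial>lborel" and "F2 \<equiv> \<integral>x. (f x)\<^sup>2 \<partial>lborel"
  shows "int_sq_bias (density lborel f) (scaled_kernel K h) f \<le> ennreal (C / real n)"
    and "K2 / h \<le> 3 * C + 2 * F2" and "F2 \<le> 2 * C / real n + 2 * (K2 / h)"
proof -
  obtain b where "integrable_kernel_mean (density lborel f) (scaled_kernel K h) b"
    by (rule integrable_kernel_mean_scaled[OF K f(1) h])
  then interpret integrable_kernel_mean "density lborel f" "scaled_kernel K h" b .
  let ?V = "int_var (density lborel f) (scaled_kernel K h)"
  let ?B = "int_sq_bias (density lborel f) (scaled_kernel K h) f"
  let ?m2 = "\<integral>\<^sup>+x. ennreal ((m x)\<^sup>2) \<partial>lborel"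
  have [measurable]: "f \<in> borel_measurable borel" by (rule prob_density_measurable[OF f(1)])
  have F2: "(\<integral>\<^sup>+x. ennreal ((f x)\<^sup>2) \<partial>lborel) = ennreal F2" and F2_nn: "0 \<le> F2"
    unfolding F2_def using f(2) by (auto simp: L2_def intro!: nn_integral_eq_integral)
  have K2_nn: "0 \<le> K2" by (simp add: K2_def)
  have two: "2 * ennreal x = ennreal (2 * x)" if "0 \<le> x" for x
    using that by (simp add: ennreal_mult)
  have VB: "?V / ennreal (real n) + ?B \<le> ennreal (C / real n)"
    using M unfolding MISE_eq[OF K f(1) h n] .
  then show B: "?B \<le> ennreal (C / real n)"
    by (rule order.trans[rotated]) simp
  have B2: "?B = (\<integral>\<^sup>+x. ennreal ((f x - m x)\<^sup>2) \<partial>lborel)"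
    unfolding int_sq_bias_def by (simp add: power2_commute)
  have Vm: "?V + ?m2 = ennreal (K2 / h)"
    unfolding K2_def by (rule int_var_add_sq_mean_scaled[OF K f(1) h])
  have "?V / ennreal (real n) \<le> ennreal (C / real n)"
    using VB by (rule order.trans[rotated]) simp
  then have "ennreal (real n) * (?V / ennreal (real n)) \<le> ennreal (real n) * ennreal (C / real n)"
    by (rule mult_left_mono) simp
  then have V: "?V \<le> ennreal C"
    using n C by (simp add: ennreal_mult[symmetric] ennreal_times_divide mult.commute[of "ennreal (real n)"] ennreal_mult_divide_eq)
  have "?B \<le> ennreal C"
    using n C by (intro order.trans[OF B] ennreal_leI) (simp add: divide_le_eq mult_le_cancel_left1)
  moreover have "?m2 \<le> 2 * ?B + 2 * ennreal F2"
    unfolding F2[symmetric] int_sq_bias_def by (rule nn_integral_sq_le) auto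
  ultimately have "ennreal (K2 / h) \<le> ennreal C + (2 * ennreal C + 2 * ennreal F2)"
    unfolding Vm[symmetric]
    by (intro add_mono V) (auto elim!: order.trans intro!: add_mono mult_left_mono)
  also have "\<dots> = ennreal (3 * C + 2 * F2)"
    using C F2_nn by (simp add: two ennreal_plus[symmetric] del: ennreal_plus)
  finally show "K2 / h \<le> 3 * C + 2 * F2"
    using C F2_nn by (subst (asm) ennreal_le_iff) auto
  have "ennreal F2 \<le> 2 * ?B + 2 * ?m2"
    unfolding F2[symmetric] B2 by (rule nn_integral_sq_le) auto
  also have "?m2 \<le> ennreal (K2 / h)" unfolding Vm[symmetric] by simp
  also note B
  finally have "ennreal F2 \<le> 2 * ennreal (C / real n) + 2 * ennreal (K2 / h)"
    by (simp add: add_mono mult_left_mono)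
  also have "\<dots> = ennreal (2 * C / real n + 2 * (K2 / h))"
    using C K2_nn h by (simp add: two ennreal_plus[symmetric] del: ennreal_plus)
  finally show "F2 \<le> 2 * C / real n + 2 * (K2 / h)"
    using C K2_nn h by (subst (asm) ennreal_le_iff) auto
qed

lemma S_K_pos_of_exact_order:
  assumes K: "std_kernel K" and f: "prob_density f" "L2 f"
    and ex: "exact_order_inv_n (\<lambda>n. Phi n f K)"
  shows "S_K K > 0"
proof -
  let ?M = "density lborel f"
  interpret M: real_distribution ?M by (rule real_distribution_prob_density[OF f(1)])
  define K2 where "K2 = (\<integral>x. (K x)\<^sup>2 \<partial>lborel)"
  define F2 where "F2 = (\<integral>x. (f x)\<^sup>2 \<partial>lborel)"
  have K2: "0 < K2" unfolding K2_def by (rule integral_std_kernel_sq_pos[OF K])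
  have F2: "0 < F2"
  proof -
    have "F2 \<noteq> 0"
    proof
      assume "F2 = 0"
      then have "AE x in lborel. (f x)\<^sup>2 = 0"
        unfolding F2_def using f(2) by (subst (asm) integral_nonneg_eq_0_iff_AE) (auto simp: L2_def)
      then have "(\<integral>\<^sup>+x. ennreal (f x) \<partial>lborel) = (\<integral>\<^sup>+x. 0 \<partial>(lborel :: real measure))"
        by (intro nn_integral_cong_AE) auto
      then show False using f(1) by (simp add: prob_density_def)
    qed
    then show ?thesis by (simp add: F2_def less_le)
  qed
  obtain c C n0 where "0 < c" "c \<le> C" and n0: "\<And>n. n \<ge> n0 \<Longrightarrow> Phi n f K \<le> ennreal (C / real n)"
    using ex unfolding exact_order_inv_n_def by blast
  then have C: "C > 0" by simp
  \<comment> \<open>Beyond \<open>n1\<close> the error term \<open>4 * C / n\<close> of the third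
    bound, taken with \<open>2 * C\<close>, is at most \<open>F2 / 2\<close>; this leaves
    \<open>F2 / 4 \<le> K2 / h\<close> and explains \<open>hi\<close> below.\<close>
  obtain n1 :: nat where n1: "real n1 > 8 * C / F2" using reals_Archimedean2 by blast
  define N where "N = max (max n0 n1) 1"
  \<comment> \<open>Doubling \<open>C\<close> makes the inequality strict, so some bandwidth has
    risk below it. The shift by \<open>N\<close> gives a bandwidth for every index.\<close>
  have "\<exists>h>0. MISE (n + N) f K h \<le> ennreal (2 * C / real (n + N))" for n
  proof -
    have "Phi (n + N) f K \<le> ennreal (C / real (n + N))" by (rule n0) (simp add: N_def)
    also have "\<dots> < ennreal (2 * C / real (n + N))"
      using C by (intro ennreal_lessI) (auto simp: N_def divide_strict_right_mono)
    finally show ?thesis unfolding Phi_def by (auto simp: INF_less_iff intro: less_imp_le)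
  qed
  then obtain h where h: "\<And>n. h n > 0" and
    mise: "\<And>n. MISE (n + N) f K (h n) \<le> ennreal (2 * C / real (n + N))"
    by metis
  have N: "n + N > 0" for n by (simp add: N_def max_def)
  have C2: "0 \<le> 2 * C" using C by simp
  note bounds = MISE_bounds[OF K f h N C2 mise, folded K2_def F2_def]
  define lo where "lo = K2 / (6 * C + 2 * F2)"
  define hi where "hi = 4 * K2 / F2"
  have lo: "lo > 0" using K2 F2 C by (simp add: lo_def)
  have "h n \<in> {lo..hi}" for n
  proof -
    have "K2 / h n \<le> 6 * C + 2 * F2" using bounds(2)[of n] C by simp
    then have 1: "lo \<le> h n" using h[of n] F2 C by (simp add: lo_def field_simps)
    have "8 * C / F2 \<le> real (n + N)" using n1 by (simp add: N_def)
    then have "8 * C \<le> F2 * real (n + N)" using F2 by (simp only: pos_divide_le_eq mult.commute)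
    then have "8 * C / real (n + N) \<le> F2"
      using N[of n] by (subst pos_divide_le_eq) (simp_all only: of_nat_0_less_iff)
    moreover have "8 * C / real (n + N) = 2 * (2 * (2 * C) / real (n + N))" by simp
    ultimately have "F2 / 4 \<le> K2 / h n" using bounds(3)[of n] by linarith
    then have "h n \<le> hi" using h[of n] F2 by (simp add: hi_def field_simps)
    with 1 show ?thesis by simp
  qed
  then obtain l r where l: "l \<in> {lo..hi}" and r: "strict_mono (r :: nat \<Rightarrow> nat)" "(h \<circ> r) \<longlonglongrightarrow> l"
    using compact_Icc[of lo hi] unfolding compact_def by metis
  have l_pos: "l > 0" using l lo by simp
  have K_int: "integrable lborel K" using K by (simp add: std_kernel_def)
  \<comment> \<open>The Fourier transform of the bias at bandwidth \<open>h\<close>.\<close>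
  let ?w = "\<lambda>h t. (charfun_K K (h * t) - 1) * char ?M t"
  have w0: "?w l t = 0" if t: "0 \<le> t" for t
  proof (rule continuous_eq_0_of_rescaled_means[OF _ _ t])
    show "isCont (?w l) t" for t
      by (intro continuous_intros M.isCont_char isCont_o2[OF _ isCont_charfun_K[OF K_int]])
  next
    fix b :: real assume b: "b > 0"
    let ?I = "\<lambda>h. \<integral>t. ?w h (b * t) \<partial>unit_uniform"
    have lim: "(\<lambda>n. ?I (h (r n))) \<longlonglongrightarrow> ?I l"
    proof (rule integral_dominated_convergence[where w="\<lambda>_. (\<integral>x. \<bar>K x\<bar> \<partial>lborel) + 1"])
      have "(\<lambda>n. charfun_K K (h (r n) * (b * t))) \<longlonglongrightarrow> charfun_K K (l * (b * t))" for t
        using r(2) unfolding comp_def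
        by (intro isCont_tendsto_compose[OF isCont_charfun_K[OF K_int]] tendsto_intros)
      then show "AE t in unit_uniform. (\<lambda>n. ?w (h (r n)) (b * t)) \<longlonglongrightarrow> ?w l (b * t)"
        by (intro AE_I2 tendsto_intros)
      have "cmod (charfun_K K s - 1) \<le> (\<integral>x. \<bar>K x\<bar> \<partial>lborel) + 1" for s
        using norm_triangle_ineq4[of "charfun_K K s" 1] norm_charfun_K_le[of K s] by simp
      then have "cmod (?w a s) \<le> ((\<integral>x. \<bar>K x\<bar> \<partial>lborel) + 1) * 1" for a s
        unfolding norm_mult by (intro mult_mono M.cmod_char_le_1) auto
      then show "AE t in unit_uniform. cmod (?w (h (r n)) (b * t)) \<le> (\<integral>x. \<bar>K x\<bar> \<partial>lborel) + 1" for n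
        by simp
    qed (use K_int in auto)
    define G where "G = 2 * C * ((\<integral>x. fejer x \<partial>lborel) / b)"
    have le: "(cmod (?I (h n)))\<^sup>2 \<le> G / real (n + N)" for n
    proof -
      have "ennreal ((cmod (?I (h n)))\<^sup>2) \<le> ennreal (2 * C / real (n + N)) * ennreal ((\<integral>x. fejer x \<partial>lborel) / b)"
        using C by (intro order.trans[OF mean_charfun_K_le_bias[OF K f(1) h b]] mult_right_mono bounds(1)) auto
      also have "\<dots> = ennreal (G / real (n + N))"
        using C b integral_fejer_pos by (simp add: ennreal_mult[symmetric] G_def)
      finally show ?thesis using C b integral_fejer_pos
        by (subst (asm) ennreal_le_iff) (auto simp: G_def)
    qed
    have G_lim: "(\<lambda>n. G / real (n + N)) \<longlonglongrightarrow> 0"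
      using LIMSEQ_ignore_initial_segment[OF lim_const_over_n[of G], of N] by simp
    have "(\<lambda>n. (cmod (?I (h n)))\<^sup>2) \<longlonglongrightarrow> 0"
      by (rule tendsto_sandwich[OF _ _ tendsto_const G_lim]) (use le in simp_all)
    then have "(\<lambda>n. (cmod (?I (h (r n))))\<^sup>2) \<longlonglongrightarrow> 0"
      using LIMSEQ_subseq_LIMSEQ[OF _ r(1), of "\<lambda>n. (cmod (?I (h n)))\<^sup>2" 0] unfolding comp_def by blast
    moreover have "(\<lambda>n. (cmod (?I (h (r n))))\<^sup>2) \<longlonglongrightarrow> (cmod (?I l))\<^sup>2"
      by (intro tendsto_intros lim)
    ultimately have "(cmod (?I l))\<^sup>2 = 0" by (rule LIMSEQ_unique[symmetric])
    then show "?I l = 0" by simp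
  qed
  \<comment> \<open>\<open>char ?M\<close> is one at \<open>0\<close> and continuous, so it can be
    cancelled for \<open>\<bar>t\<bar> < d\<close>; rescaling by \<open>l\<close> gives the interval
    up to \<open>l * d\<close> for \<open>K\<close>.\<close>
  have "\<forall>\<^sub>F t in at 0. char ?M t \<noteq> 0"
    using M.isCont_char[of 0] M.char_zero unfolding isCont_def
    by (intro tendsto_imp_eventually_ne[where c="char ?M 0"]) auto
  then obtain d where d: "d > 0" "\<And>t. t \<noteq> 0 \<Longrightarrow> \<bar>t\<bar> < d \<Longrightarrow> char ?M t \<noteq> 0"
    unfolding eventually_at by (auto simp: dist_real_def)
  show ?thesis
  proof (rule S_K_pos_of_local[OF K])
    show "l * d > 0" using l_pos d by simp
    fix t assume t: "0 \<le> t" "t < l * d"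
    have "char ?M (t / l) \<noteq> 0"
      using d(2)[of "t / l"] t l_pos M.char_zero by (cases "t = 0") (auto simp: field_simps)
    then show "charfun_K K t = 1" using w0[of "t / l"] t l_pos by simp
  qed
qed

theorem theorem2:
  fixes K :: "real \<Rightarrow> real"
  assumes "std_kernel K" and "L2 K" and "S_K K = T_K K"
  shows "S_K K > 0 \<longleftrightarrow>
    (\<exists>f. prob_density f \<and> L2 f \<and> exact_order_inv_n (\<lambda>n. Phi n f K))"
  \<comment> \<open>The witness for the forward direction is the Fejer density, the same for every
    \<open>K\<close>.\<close>
  using exact_order_fejer_density[OF assms(1)] S_K_pos_of_exact_order[OF assms(1)]
    prob_density_fejer L2_fejer_density by blast

end
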